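(* Let $n>0$ be an even integer and let $w=e^{\pi i/4}$. For $s\in\mathbb{C}$ put $$Z_n(s)=\sum_{\substack{d_1d_2=n\\ d_1,d_2>0}} u\!\left(\frac{d_2}{d_1}\right)\frac{d_1^{\,s}}{\sqrt{\gcd(d_1,d_2)}},\qquad L_n(s)=n^{-s/2}Z_n(s),$$ and for each prime $p\mid n$, with $\alpha_p$ the exponent of $p$ in $n$, $$Z_{n,p}(s)=\sum_{k=0}^{\alpha_p} u\!\left(\frac{n/p^k}{p^k}\right)\frac{p^{ks}}{\sqrt{\gcd(p^k,n/p^k)}}.$$ Then: (a) $L_n(1-s)=w\cdot\overline{L_n(\overline{s})}$ for all $s\in\mathbb{C}$; (b) $Z_n(s)=\prod_{p\mid n,\ p\text{ prime}} Z_{n,p}(s)$ for all $s\in\mathbb{C}$; (c) if $Z_n(s)=0$ then $\Re(s)=\tfrac12$.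
   Context: $e(x)=e^{2\pi i x}$. For integers $p,q$ with $q>0$, $U(p,q)=\frac{1}{2q}\sum_{x=0}^{2q-1} e\!\left(\frac{px^2}{2q}\right)$; one has $U(pr,qr)=U(p,q)$ for integers $r>0$, so $u:\mathbb{Q}\to\mathbb{C}$, $u(p/q)=U(p,q)$ (for $p\in\mathbb{Z}$, $q\in\mathbb{Z}_{>0}$) is well defined. *)

theory Defs
  imports "HOL-Analysis.Analysis" "HOL-Computational_Algebra.Primes"
begin

definition e :: "real \<Rightarrow> complex" where
  "e x = exp (2 * of_real pi * \<i> * of_real x)"

definition U :: "int \<Rightarrow> int \<Rightarrow> complex" where
  "U p q = 1 / (2 * of_int q) * (\<Sum>x = 0..2 * q - 1. e (of_int (p * x\<^sup>2) / of_int (2 * q)))"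

text \<open>The value is taken at the reduced fraction with positive denominator;
  the lemma \<open>u_of_int_divide\<close> below shows that any fraction with positive denominator gives the same value.\<close>

definition u :: "rat \<Rightarrow> complex" where
  "u r = (case quotient_of r of (p, q) \<Rightarrow> U p q)"

definition Z :: "nat \<Rightarrow> complex \<Rightarrow> complex" where
  "Z n s = (\<Sum>(d1, d2) \<in> {(d1, d2). d1 * d2 = n \<and> d1 > 0 \<and> d2 > 0}.
     u (of_nat d2 / of_nat d1) * (of_nat d1 powr s / of_real (sqrt (of_nat (gcd d1 d2)))))"

definition L :: "nat \<Rightarrow> complex \<Rightarrow> complex" where
  "L n s = of_nat n powr (- s / 2) * Z n s"

definition Z_local :: "nat \<Rightarrow> nat \<Rightarrow> complex \<Rightarrow> complex" where
  "Z_local n p s = (\<Sum>k = 0..multiplicity p n.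
     u (of_nat (n div p ^ k) / of_nat (p ^ k)) *
       (of_nat p powr (of_nat k * s) / of_real (sqrt (of_nat (gcd (p ^ k) (n div p ^ k))))))"

lemma e_add_int: "e (x + of_int k) = e x"
proof -
  have "e (x + of_int k) = e x * exp (2 * of_int k * of_real pi * \<i>)"
    unfolding e_def exp_add [symmetric] by (rule arg_cong [of _ _ exp]) (simp add: algebra_simps)
  also have "exp (2 * of_int k * of_real pi * \<i>) = 1"
    using exp_integer_2pi [of "of_int k"] by (simp add: mult_ac)
  finally show ?thesis by simp
qed

lemma U_mult_right:
  assumes "q > 0" "r > 0"
  shows "U (p * r) (q * r) = U p q"
proof -
  define f where "f = (\<lambda>x::int. e (of_int (p * x\<^sup>2) / of_int (2 * q)))"
  have period: "f (x + 2 * q * k) = f x" for x k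
  proof -
    have "of_int (p * (x + 2 * q * k)\<^sup>2) / of_int (2 * q) =
        (of_int (p * x\<^sup>2) / of_int (2 * q) + of_int (p * (2 * x * k + 2 * q * k\<^sup>2)) :: real)"
      using assms by (simp add: field_simps power2_eq_square)
    then show ?thesis by (simp only: f_def e_add_int)
  qed
  have "(\<Sum>x = 0..2 * (q * int m) - 1. f x) = of_nat m * (\<Sum>x = 0..2 * q - 1. f x)" for m
  proof (induction m)
    case 0
    then show ?case by simp
  next
    case (Suc m)
    define c where "c = 2 * q * int m"
    have c0: "c \<ge> 0" using assms by (simp add: c_def)
    have split: "{0..2 * (q * int (Suc m)) - 1} = {0..c - 1} \<union> {c..c + (2 * q - 1)}"
    proof -
      have "2 * (q * int (Suc m)) - 1 = c + (2 * q - 1)" by (simp add: c_def algebra_simps)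
      then show ?thesis using c0 assms by auto
    qed
    have "(\<Sum>x = 0..2 * (q * int (Suc m)) - 1. f x) =
        (\<Sum>x = 0..c - 1. f x) + (\<Sum>x = c..c + (2 * q - 1). f x)"
      unfolding split by (rule sum.union_disjoint) auto
    also have "(\<Sum>x = c..c + (2 * q - 1). f x) = (\<Sum>x = 0..2 * q - 1. f (x + c))"
      by (rule sum.reindex_bij_witness [of _ "\<lambda>x. x + c" "\<lambda>x. x - c"]) auto
    also have "\<dots> = (\<Sum>x = 0..2 * q - 1. f x)"
      using period by (simp add: c_def)
    finally show ?case
      using Suc by (simp add: c_def algebra_simps)
  qed
  from this [of "nat r"] have sum: "(\<Sum>x = 0..2 * (q * r) - 1. f x) = of_int r * (\<Sum>x = 0..2 * q - 1. f x)"
    using assms by (simp add: of_nat_nat)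
  have "U (p * r) (q * r) = 1 / (2 * of_int (q * r)) * (\<Sum>x = 0..2 * (q * r) - 1. f x)"
    unfolding U_def f_def using assms by (simp add: mult_ac)
  also have "\<dots> = U p q"
    unfolding sum using assms by (simp add: U_def f_def)
  finally show ?thesis .
qed

lemma u_of_int_divide:
  assumes "q > 0"
  shows "u (of_int p / of_int q) = U p q"
proof -
  obtain a b where ab: "quotient_of (of_int p / of_int q) = (a, b)" by fastforce
  have b: "b > 0" using quotient_of_denom_pos [OF ab] .
  have "of_int p / of_int q = (of_int a / of_int b :: rat)" using quotient_of_div [OF ab] .
  then have "(of_int (p * b) :: rat) = of_int (a * q)"
    using assms b by (simp add: field_simps)
  then have eq: "p * b = a * q" by (simp only: of_int_eq_iff)
  have "U p q = U (p * b) (q * b)" using U_mult_right assms b by simp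
  also have "\<dots> = U (a * q) (b * q)" by (simp only: eq mult.commute [of q b])
  also have "\<dots> = U a b" using U_mult_right assms b by simp
  finally show ?thesis by (simp add: u_def ab)
qed

end

theory Submission
  imports Defs
begin

text \<open>
  Everything rests on the reciprocity law \<open>u(p/q) = w \<surd>(p/q) cnj (u(q/p))\<close>, which is the functional
  equation termwise under \<open>d\<^sub>1 \<leftrightarrow> d\<^sub>2\<close>.  Let \<open>S(p,q) = \<Sum>\<^bsub>x mod q\<^esub> exp(\<pi>ipx\<^sup>2/q)\<close> for \<open>pq\<close> even.  The Chinese remainder
  theorem gives \<open>S(1,pq) = S(p,q) S(q,p)\<close> for coprime \<open>p, q\<close>, and \<open>|S(q,p)|\<^sup>2 = p\<close>, so reciprocity
  reduces to \<open>S(1,n) = w \<surd>n\<close> for even \<open>n\<close>.  Here \<open>S(1,nr\<^sup>2) = r S(1,n)\<close>, so \<open>S(1,N)/\<surd>N\<close> does not change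
  when \<open>N\<close> is multiplied by a square.  On the other hand, up to a relative error \<open>O(1/A)\<close>,
  \<open>S(1,N)\<close> is determined by its first \<open>A\<surd>N\<close> terms, which hardly change when \<open>N\<close> is perturbed by
  \<open>O(\<surd>N)\<close>.  Comparing \<open>nr\<^sup>2\<close> with the nearest \<open>2r'\<^sup>2\<close> from below and letting \<open>r \<rightarrow> \<infinity>\<close> shows that \<open>S(1,n)/\<surd>n\<close> equals
  \<open>S(1,2)/\<surd>2 = (1 + i)/\<surd>2 = w\<close>.

  The Chinese remainder theorem also makes the summand of \<open>Z\<^sub>n\<close> multiplicative in \<open>d\<^sub>1\<close>, whence the Euler
  product.  Finally, let \<open>n = p\<^sup>\<alpha> m\<close> with \<open>p\<close> not dividing \<open>m\<close>, and put \<open>Y = p\<^bsup>s-1/2\<^esup>\<close>.  By reciprocity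
  \<open>p\<^bsup>j/2\<^esup> u(m/p\<^sup>j)\<close> depends only on the parity of \<open>j\<close>, so the local factor is either \<open>1 + Y + \<dots> + Y\<^sup>\<alpha>\<close> or
  \<open>(1 + \<dots> + Y\<^bsup>a-1\<^esup>)(1 + \<gamma>Y\<^sup>b)\<close> with \<open>|\<gamma>| = 1\<close>; all its zeros have \<open>|Y| = 1\<close>.
\<close>

section \<open>Quadratic Gauss sums\<close>

text \<open>Half the speed of \<open>e\<close>: the period is 2, hence the parity conditions
  below.\<close>

definition eh :: "real \<Rightarrow> complex" where
  "eh t = cis (pi * t)"

text \<open>This is S(p,q). It runs over \<open>q\<close> residues, half the range used in
  \<open>U\<close>; for even \<open>p * q\<close> the summand depends only on \<open>x\<close> mod
  \<open>q\<close>.\<close>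

definition gauss_sum :: "int \<Rightarrow> int \<Rightarrow> complex" where
  "gauss_sum p q = (\<Sum>x = 0..<q. eh (of_int (p * x\<^sup>2) / of_int q))"

section \<open>The half-period exponential\<close>

lemma eh_add: "eh (s + t) = eh s * eh t"
  by (simp add: eh_def cis_mult algebra_simps)

lemma eh_0 [simp]: "eh 0 = 1"
  by (simp add: eh_def)

lemma norm_eh [simp]: "norm (eh t) = 1"
  by (simp add: eh_def)

lemma cnj_eh: "cnj (eh t) = eh (- t)"
  by (simp add: eh_def cis_cnj)

lemma eh_even [simp]: "eh (2 * of_int k) = 1"
  using cis_multiple_2pi[of "of_int k"] by (simp add: eh_def mult_ac)

lemma eh_add_even: "eh (t + 2 * of_int k) = eh t"
  by (simp add: eh_add)

lemma eh_even_int: "even k \<Longrightarrow> eh (of_int k) = 1"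
  by (auto elim!: evenE)

lemma eh_odd: "odd k \<Longrightarrow> eh (of_int k) = - 1"
  by (auto elim!: oddE simp: eh_add) (simp add: eh_def)

lemma eh_eq_1_iff: "eh (2 * t) = 1 \<longleftrightarrow> t \<in> \<int>"
proof
  assume "eh (2 * t) = 1"
  then have "cos (2 * pi * t) = 1"
    by (simp add: eh_def complex_eq_iff mult_ac)
  then obtain k :: int where "2 * pi * t = of_int k * 2 * pi"
    using cos_one_2pi_int[of "2 * pi * t"] by auto
  then show "t \<in> \<int>" by simp
qed (auto elim!: Ints_cases)

lemma e_eq_eh: "e t = eh (2 * t)"
  by (simp add: e_def eh_def cis_conv_exp mult_ac)

text \<open>Counting turns injectivity modulo \<open>q\<close> into a bijection with the residues.
  The index type is free so that pairs may enumerate residues, as in the Chinese remainder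
  theorem.\<close>

lemma sum_complete_residues:
  fixes f :: "int \<Rightarrow> 'b::comm_monoid_add" and g :: "'a \<Rightarrow> int"
  assumes per: "\<And>x. f (x mod q) = f x" and q: "q > 0"
    and A: "finite A" "int (card A) = q" and inj: "inj_on (\<lambda>y. g y mod q) A"
  shows "(\<Sum>y\<in>A. f (g y)) = (\<Sum>x = 0..<q. f x)"
proof -
  have "(\<lambda>y. g y mod q) ` A = {0..<q}"
    using A inj q by (intro card_subset_eq) (auto simp: card_image)
  then have "bij_betw (\<lambda>y. g y mod q) A {0..<q}"
    using inj by (simp add: bij_betw_def)
  from sum.reindex_bij_betw[OF this, of f] show ?thesis by (simp add: per)
qed

lemma eq_if_dvd_diff_bounded:
  fixes x y :: int
  assumes "0 \<le> x" "x < q" "0 \<le> y" "y < q" "q dvd x - y"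
  shows "x = y"
  using assms by (metis mod_eq_dvd_iff mod_pos_pos_trivial)

lemma sum_periodic_shift:
  fixes f :: "int \<Rightarrow> 'b::comm_monoid_add"
  assumes "\<And>x. f (x mod q) = f x" "q > 0"
  shows "(\<Sum>x = 0..<q. f (x + h)) = (\<Sum>x = 0..<q. f x)"
proof (rule sum_complete_residues[of f q "{0..<q}" "\<lambda>x. x + h"])
  show "inj_on (\<lambda>x. (x + h) mod q) {0..<q}"
    by (rule inj_onI, rule eq_if_dvd_diff_bounded[of _ q]) (auto simp: mod_eq_dvd_iff)
qed (use assms in auto)

text \<open>Shifting \<open>x\<close> by one multiplies the sum by its term at 1, which differs from
  1 unless \<open>q\<close> divides \<open>a\<close>.\<close>

lemma sum_eh_character:
  assumes "q > 0"
  shows "(\<Sum>x = 0..<q. eh (2 * of_int (a * x) / of_int q)) = (if q dvd a then of_int q else 0)"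
proof (cases "q dvd a")
  case True
  then obtain b where "a = q * b" by auto
  then have "eh (2 * of_int (a * x) / of_int q) = 1" for x
    using assms eh_even[of "b * x"] by simp
  then show ?thesis using True assms by simp
next
  case False
  define f where "f = (\<lambda>x::int. eh (2 * of_int (a * x) / of_int q))"
  have per: "f (x mod q) = f x" for x
  proof -
    define r k where "r = x mod q" and "k = x div q"
    have "x = r + q * k" by (simp add: r_def k_def)
    then have "2 * of_int (a * x) / of_int q = (2 * of_int (a * r) / of_int q + 2 * of_int (a * k) :: real)"
      using assms by (simp add: field_simps)
    then show ?thesis by (simp only: f_def r_def eh_add_even)
  qed
  have "(\<Sum>x = 0..<q. f x) = (\<Sum>x = 0..<q. f (x + 1))"
    using sum_periodic_shift[of f q, OF per assms] by simp
  also have "\<dots> = (\<Sum>x = 0..<q. f 1 * f x)"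
    by (simp add: f_def eh_add[symmetric] algebra_simps add_divide_distrib)
  finally have "(f 1 - 1) * (\<Sum>x = 0..<q. f x) = 0"
    by (simp add: sum_distrib_left[symmetric] left_diff_distrib)
  moreover have "f 1 \<noteq> 1"
  proof
    assume "f 1 = 1"
    then have "of_int a / of_int q \<in> (\<int> :: real set)"
      using eh_eq_1_iff[of "of_int a / of_int q"] by (simp add: f_def)
    then show False using False assms
      by (auto elim!: Ints_cases simp: field_simps simp flip: of_int_mult)
  qed
  ultimately show ?thesis using False by (simp add: f_def)
qed

text \<open>Passing from \<open>r\<close> to \<open>r + q * k\<close> adds
  \<open>2 * p * r * k + p * q * k\<^sup>2\<close> to the exponent, an even integer when
  \<open>p * q\<close> is even.\<close>

lemma eh_quadratic_mod:
  assumes "q > 0" "even (p * q)"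
  shows "eh (of_int (p * (x mod q)\<^sup>2) / of_int q) = eh (of_int (p * x\<^sup>2) / of_int q)"
proof -
  define r k where "r = x mod q" and "k = x div q"
  have x: "x = r + q * k" by (simp add: r_def k_def)
  obtain c where c: "p * q = 2 * c" using assms by auto
  have "p * x\<^sup>2 = p * r\<^sup>2 + (2 * (p * r * k) + p * q * k\<^sup>2) * q"
    by (simp add: x power2_eq_square algebra_simps)
  also have "2 * (p * r * k) + p * q * k\<^sup>2 = 2 * (p * r * k + c * k\<^sup>2)"
    by (simp add: c algebra_simps)
  finally have "of_int (p * x\<^sup>2) / of_int q = (of_int (p * r\<^sup>2) / of_int q + 2 * of_int (p * r * k + c * k\<^sup>2) :: real)"
    using assms(1) by (simp add: field_simps)
  then show ?thesis by (simp only: r_def eh_add_even)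
qed

lemma gauss_sum_second_period:
  assumes "q > 0"
  shows "(\<Sum>x = q..<2 * q. eh (of_int (p * x\<^sup>2) / of_int q)) = eh (of_int (p * q)) * gauss_sum p q"
proof -
  have "(\<Sum>x = q..<2 * q. eh (of_int (p * x\<^sup>2) / of_int q)) =
      (\<Sum>x = 0..<q. eh (of_int (p * (x + q)\<^sup>2) / of_int q))"
    by (rule sum.reindex_bij_witness[of _ "\<lambda>x. x + q" "\<lambda>x. x - q"]) auto
  also have "\<dots> = (\<Sum>x = 0..<q. eh (of_int (p * q)) * eh (of_int (p * x\<^sup>2) / of_int q))"
  proof (rule sum.cong [OF refl])
    fix x
    have "of_int (p * (x + q)\<^sup>2) / of_int q =
        (of_int (p * q) + of_int (p * x\<^sup>2) / of_int q + 2 * of_int (p * x) :: real)"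
      using assms by (simp add: field_simps power2_eq_square)
    then show "eh (of_int (p * (x + q)\<^sup>2) / of_int q) = eh (of_int (p * q)) * eh (of_int (p * x\<^sup>2) / of_int q)"
      by (simp only: eh_add eh_even mult_1_right)
  qed
  finally show ?thesis by (simp add: gauss_sum_def sum_distrib_left)
qed

text \<open>The two halves of the range of \<open>U\<close> differ by the sign
  \<open>eh (of_int (p * q))\<close>: they agree for even \<open>p * q\<close> and cancel for
  odd.\<close>

lemma U_eq_gauss_sum_parity:
  assumes "q > 0"
  shows "U p q = (1 + eh (of_int (p * q))) * gauss_sum p q / (2 * of_int q)"
proof -
  have "(\<Sum>x = 0..2 * q - 1. e (of_int (p * x\<^sup>2) / of_int (2 * q))) =
      (\<Sum>x = 0..<2 * q. eh (of_int (p * x\<^sup>2) / of_int q))"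
    by (rule sum.cong) (auto simp: e_eq_eh)
  also have "{0..<2 * q} = {0..<q} \<union> {q..<2 * q}"
    using assms by auto
  also have "(\<Sum>x\<in>\<dots>. eh (of_int (p * x\<^sup>2) / of_int q)) =
      gauss_sum p q + (\<Sum>x = q..<2 * q. eh (of_int (p * x\<^sup>2) / of_int q))"
    unfolding gauss_sum_def by (rule sum.union_disjoint) auto
  finally show ?thesis
    unfolding U_def using gauss_sum_second_period[OF assms, of p] by (simp add: algebra_simps add_divide_distrib)
qed

lemma U_eq_gauss_sum: "q > 0 \<Longrightarrow> even (p * q) \<Longrightarrow> U p q = gauss_sum p q / of_int q"
  using eh_even_int[of "p * q"] by (simp add: U_eq_gauss_sum_parity)

lemma U_odd: "q > 0 \<Longrightarrow> odd (p * q) \<Longrightarrow> U p q = 0"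
  using eh_odd[of "p * q"] by (simp add: U_eq_gauss_sum_parity)

lemma U_1: "U a 1 = (if even a then 1 else 0)"
proof -
  have "{0..<1::int} = {0}" by auto
  then show ?thesis by (simp add: U_eq_gauss_sum U_odd gauss_sum_def)
qed

text \<open>Residues are written \<open>b * z + a * y\<close>; the cross term
  \<open>2 * m * z * y\<close> is an even integer, so the summand splits. \<open>m = 1\<close>
  serves reciprocity, general \<open>m\<close> the Euler product.\<close>

lemma gauss_sum_mult_coprime:
  assumes "a > 0" "b > 0" "coprime a b" "even (m * a * b)"
  shows "gauss_sum m (a * b) = gauss_sum (m * b) a * gauss_sum (m * a) b"
proof -
  let ?f = "\<lambda>x. eh (of_int (m * x\<^sup>2) / of_int (a * b))"
  have "gauss_sum m (a * b) = (\<Sum>(z, y)\<in>{0..<a} \<times> {0..<b}. ?f (b * z + a * y))"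
    unfolding gauss_sum_def case_prod_unfold
  proof (rule sum_complete_residues[symmetric])
    show "inj_on (\<lambda>t. (b * fst t + a * snd t) mod (a * b)) ({0..<a} \<times> {0..<b})"
    proof (rule inj_onI, clarsimp)
      fix z y z' y'
      assume *: "0 \<le> z" "z < a" "0 \<le> y" "y < b" "0 \<le> z'" "z' < a" "0 \<le> y'" "y' < b"
        and "(b * z + a * y) mod (a * b) = (b * z' + a * y') mod (a * b)"
      then have "a * b dvd b * (z - z') + a * (y - y')"
        by (simp add: mod_eq_dvd_iff algebra_simps)
      then have "a dvd b * (z - z') + a * (y - y')" "b dvd b * (z - z') + a * (y - y')"
        using dvd_mult_left dvd_mult_right by blast+
      then have "a dvd b * (z - z')" "b dvd a * (y - y')"
        by (simp_all add: dvd_add_left_iff dvd_add_right_iff)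
      then have "a dvd z - z'" "b dvd y - y'"
        using assms(3) by (simp_all add: coprime_dvd_mult_right_iff coprime_commute)
      then show "z = z' \<and> y = y'" using * eq_if_dvd_diff_bounded by blast
    qed
  qed (use assms in \<open>auto simp: eh_quadratic_mod simp del: of_int_mult\<close>)
  also have "\<dots> = (\<Sum>(z, y)\<in>{0..<a} \<times> {0..<b}.
      eh (of_int (m * b * z\<^sup>2) / of_int a) * eh (of_int (m * a * y\<^sup>2) / of_int b))"
  proof (rule sum.cong [OF refl], clarify)
    fix z y
    have "of_int (m * (b * z + a * y)\<^sup>2) / of_int (a * b) =
        (of_int (m * b * z\<^sup>2) / of_int a + of_int (m * a * y\<^sup>2) / of_int b + 2 * of_int (m * z * y) :: real)"
      using assms by (simp add: field_simps power2_eq_square)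
    then show "?f (b * z + a * y) = eh (of_int (m * b * z\<^sup>2) / of_int a) * eh (of_int (m * a * y\<^sup>2) / of_int b)"
      by (simp only: eh_add eh_even mult_1_right)
  qed
  finally show ?thesis
    by (simp add: gauss_sum_def sum_product sum.cartesian_product)
qed

text \<open>Residues are written \<open>y + n * r * z\<close>. The sum over \<open>z\<close> is a
  character sum modulo \<open>r\<close>, which leaves only \<open>y = r * t\<close>; the term
  \<open>n * z\<^sup>2\<close> is even.\<close>

lemma gauss_sum_square_mult:
  assumes "n > 0" "r > 0" "even n"
  shows "gauss_sum 1 (n * r\<^sup>2) = of_int r * gauss_sum 1 n"
proof -
  let ?f = "\<lambda>x. eh (of_int (1 * x\<^sup>2) / of_int (n * r\<^sup>2))"
  obtain c where c: "n = 2 * c" using assms by auto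
  have "gauss_sum 1 (n * r\<^sup>2) = (\<Sum>(y, z)\<in>{0..<n * r} \<times> {0..<r}. ?f (y + n * r * z))"
    unfolding gauss_sum_def case_prod_unfold
  proof (rule sum_complete_residues[symmetric])
    show "inj_on (\<lambda>t. (fst t + n * r * snd t) mod (n * r\<^sup>2)) ({0..<n * r} \<times> {0..<r})"
    proof (rule inj_onI, clarsimp)
      fix z y z' y'
      assume *: "0 \<le> y" "y < n * r" "0 \<le> z" "z < r" "0 \<le> y'" "y' < n * r" "0 \<le> z'" "z' < r"
        and "(y + n * r * z) mod (n * r\<^sup>2) = (y' + n * r * z') mod (n * r\<^sup>2)"
      then have d: "n * r * r dvd (y - y') + n * r * (z - z')"
        by (simp add: mod_eq_dvd_iff algebra_simps power2_eq_square)
      then have "n * r dvd (y - y') + n * r * (z - z')"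
        by (rule dvd_mult_left)
      then have "n * r dvd y - y'" by (simp add: dvd_add_left_iff)
      then have y: "y = y'" using * eq_if_dvd_diff_bounded by blast
      then have "r dvd z - z'" using d assms by simp
      then show "y = y' \<and> z = z'" using * y eq_if_dvd_diff_bounded by blast
    qed
    show "int (card ({0..<n * r} \<times> {0..<r})) = n * r\<^sup>2"
      using assms by (simp add: power2_eq_square)
  qed (use assms eh_quadratic_mod[of "n * r\<^sup>2" 1] in \<open>auto simp del: of_int_mult\<close>)
  also have "\<dots> = (\<Sum>(y, z)\<in>{0..<n * r} \<times> {0..<r}. ?f y * eh (2 * of_int (y * z) / of_int r))"
  proof (rule sum.cong [OF refl], clarify)
    fix y z
    have "of_int (1 * (y + n * r * z)\<^sup>2) / of_int (n * r\<^sup>2) =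
        (of_int (1 * y\<^sup>2) / of_int (n * r\<^sup>2) + 2 * of_int (y * z) / of_int r + 2 * of_int (c * z\<^sup>2) :: real)"
      using assms by (simp add: c field_simps power2_eq_square)
    then show "?f (y + n * r * z) = ?f y * eh (2 * of_int (y * z) / of_int r)"
      by (simp only: eh_add eh_even mult_1_right)
  qed
  also have "\<dots> = (\<Sum>y = 0..<n * r. ?f y * (\<Sum>z = 0..<r. eh (2 * of_int (y * z) / of_int r)))"
    by (simp add: sum_distrib_left sum.cartesian_product)
  also have "\<dots> = (\<Sum>y\<in>{0..<n * r}. if r dvd y then of_int r * ?f y else 0)"
    by (rule sum.cong[OF refl]) (use sum_eh_character[OF assms(2)] in \<open>simp add: mult_ac\<close>)
  also have "\<dots> = (\<Sum>y\<in>{y \<in> {0..<n * r}. r dvd y}. of_int r * ?f y)"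
    by (rule sum.inter_filter[symmetric]) simp
  also have "\<dots> = (\<Sum>t = 0..<n. of_int r * eh (of_int (1 * t\<^sup>2) / of_int n))"
    by (rule sum.reindex_bij_witness[of _ "\<lambda>t. r * t" "\<lambda>y. y div r"])
       (use assms in \<open>auto simp: power_mult_distrib zero_le_mult_iff mult.commute[of n] elim!: dvdE\<close>)
  finally show ?thesis by (simp add: gauss_sum_def sum_distrib_left)
qed

text \<open>Shifting one variable by the other cancels the squares in \<open>y\<close>; the sum over
  \<open>y\<close> is then a character sum which, by coprimality, vanishes unless
  \<open>x = 0\<close>.\<close>

lemma gauss_sum_mult_cnj:
  assumes "q > 0" "coprime p q" "even (p * q)"
  shows "gauss_sum p q * cnj (gauss_sum p q) = of_int q"
proof -
  let ?f = "\<lambda>x. eh (of_int (p * x\<^sup>2) / of_int q)"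
  have "gauss_sum p q * cnj (gauss_sum p q) = (\<Sum>y = 0..<q. cnj (?f y) * (\<Sum>x = 0..<q. ?f (x + y)))"
  proof -
    have "(\<Sum>x = 0..<q. ?f (x + y)) = gauss_sum p q" for y
      unfolding gauss_sum_def using assms by (intro sum_periodic_shift eh_quadratic_mod)
    then show ?thesis
      by (simp add: gauss_sum_def sum_distrib_right[symmetric] mult.commute)
  qed
  also have "\<dots> = (\<Sum>y = 0..<q. \<Sum>x = 0..<q. ?f x * eh (2 * of_int (p * x * y) / of_int q))"
    unfolding sum_distrib_left
  proof (intro sum.cong refl)
    fix x y
    have "of_int (p * (x + y)\<^sup>2) / of_int q =
        (of_int (p * y\<^sup>2) / of_int q + (of_int (p * x\<^sup>2) / of_int q + 2 * of_int (p * x * y) / of_int q) :: real)"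
      by (simp add: power2_eq_square algebra_simps add_divide_distrib)
    then have "?f (x + y) = ?f y * (?f x * eh (2 * of_int (p * x * y) / of_int q))"
      by (simp only: eh_add)
    moreover have "cnj (?f y) * ?f y = 1"
      by (simp add: cnj_eh eh_add[symmetric])
    ultimately show "cnj (?f y) * ?f (x + y) = ?f x * eh (2 * of_int (p * x * y) / of_int q)"
      by (metis mult.assoc mult_1)
  qed
  also have "\<dots> = (\<Sum>x = 0..<q. ?f x * (\<Sum>y = 0..<q. eh (2 * of_int (p * x * y) / of_int q)))"
    by (subst sum.swap) (simp add: sum_distrib_left)
  also have "\<dots> = (\<Sum>x = 0..<q. if x = 0 then of_int q else 0)"
  proof (rule sum.cong [OF refl])
    fix x assume x: "x \<in> {0..<q}"
    have "q dvd p * x \<longleftrightarrow> x = 0"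
      using assms(2) x eq_if_dvd_diff_bounded[of x q 0] by (auto simp: coprime_dvd_mult_right_iff coprime_commute)
    then show "?f x * (\<Sum>y = 0..<q. eh (2 * of_int (p * x * y) / of_int q)) = (if x = 0 then of_int q else 0)"
      using sum_eh_character[OF assms(1), of "p * x"] by simp
  qed
  finally show ?thesis using assms(1) by simp
qed

section \<open>Truncation of the Gauss sum\<close>

text \<open>Abel summation: \<open>c M\<close> controls both the boundary terms and the total
  variation of the decreasing weights.\<close>

lemma norm_sum_diff_mult_antimono:
  fixes a :: "nat \<Rightarrow> 'a::real_normed_algebra_1" and c :: "nat \<Rightarrow> real"
  assumes a: "\<And>x. norm (a x) \<le> 1" and c: "\<And>x. M \<le> x \<Longrightarrow> x < K \<Longrightarrow> 0 \<le> c x"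
    and mono: "\<And>x. M \<le> x \<Longrightarrow> Suc x < K \<Longrightarrow> c (Suc x) \<le> c x" and "M < K"
  shows "norm (\<Sum>x = M..<K. (a (Suc x) - a x) * of_real (c x)) \<le> 2 * c M"
proof -
  let ?S = "\<lambda>k. \<Sum>x = M..<k. (a (Suc x) - a x) * of_real (c x)"
  have scaled: "norm (a x * of_real t) \<le> t" if "0 \<le> t" for x t
  proof -
    have "norm (a x * of_real t) \<le> norm (a x) * t"
      using norm_mult_ineq[of "a x" "of_real t"] that by simp
    also have "\<dots> \<le> 1 * t" using a that by (intro mult_right_mono) auto
    finally show ?thesis by simp
  qed
  \<comment> \<open>The invariant removes the boundary term at \<open>k\<close>, whose weight is the
    last one used, \<open>c (k - 1)\<close>; each step then adds only a decrement of
    \<open>c\<close>, so the bounds telescope.\<close>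
  have "Suc M \<le> k \<Longrightarrow> k \<le> K \<longrightarrow> norm (?S k - a k * of_real (c (k - 1))) \<le> 2 * c M - c (k - 1)" for k
  proof (induction k rule: dec_induct)
    case base
    show ?case using scaled[of "c M" M] c[of M] by (auto simp: algebra_simps)
  next
    case (step k)
    show ?case
    proof
      assume k: "Suc k \<le> K"
      obtain j where j: "k = Suc j" "M \<le> j" using step.hyps by (cases k) auto
      have "?S (Suc k) - a (Suc k) * of_real (c k) =
          (?S k - a k * of_real (c j)) + a k * of_real (c j - c k)"
        using step.hyps by (simp add: algebra_simps)
      also have "norm \<dots> \<le> (2 * c M - c j) + (c j - c k)"
        using step.IH k j mono[of j] by (intro norm_triangle_mono scaled) auto
      finally show "norm (?S (Suc k) - a (Suc k) * of_real (c (Suc k - 1))) \<le> 2 * c M - c (Suc k - 1)"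
        by simp
    qed
  qed
  from this[of K] have "norm (?S K - a K * of_real (c (K - 1))) \<le> 2 * c M - c (K - 1)"
    using \<open>M < K\<close> by simp
  moreover have "norm (a K * of_real (c (K - 1))) \<le> c (K - 1)"
    using \<open>M < K\<close> c[of "K - 1"] by (intro scaled) auto
  ultimately show ?thesis
    using norm_triangle_sub[of "?S K" "a K * of_real (c (K - 1))"] by linarith
qed

lemma cis_double_minus_1_mult_cot:
  assumes "sin y \<noteq> 0"
  shows "(cis (2 * y) - 1) * (- 1 / 2 - \<i> / 2 * of_real (cot y)) = 1"
proof -
  have dbl: "cis (2 * y) = Complex (1 - 2 * (sin y)\<^sup>2) (2 * sin y * cos y)"
    by (simp add: complex_eq_iff cos_double_sin sin_double)
  have sc: "sin y * sin y + cos y * cos y = 1"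
    using sin_cos_squared_add[of y] by (simp add: power2_eq_square)
  show ?thesis
    unfolding dbl using assms
    by (simp add: complex_eq_iff cot_def field_simps power2_eq_square) (use sc in algebra)
qed

lemma cot_antimono:
  assumes "0 < x" "x \<le> y" "y < pi / 2"
  shows "cot y \<le> cot x"
proof -
  have "tan x \<le> tan y" "0 < tan x" using assms by (auto intro: tan_mono_le tan_gt_zero)
  then show ?thesis by (simp add: cot_altdef le_imp_inverse_le)
qed

lemma cot_le_inverse:
  assumes "0 < x" "x < pi / 2"
  shows "cot x \<le> 1 / x"
proof -
  have "x \<le> tan x" using abs_tan_ge[of x] assms tan_gt_zero[of x] by simp
  then show ?thesis using assms by (simp add: cot_altdef le_imp_inverse_le inverse_eq_divide[symmetric])
qed

text \<open>For \<open>M\<close> of order A sqrt(N) the bound is O(sqrt(N) / A) for large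
  \<open>N\<close>, small against the size sqrt(N) of the whole sum.\<close>

lemma norm_quadratic_sum_tail:
  assumes "0 < M" "M \<le> K" "N = 2 * K"
  shows "norm (\<Sum>x = M..<K. eh (real x ^ 2 / real N)) \<le> 1 + real N / real M"
proof (cases "M = K")
  case False
  then have "M < K" using assms by simp
  define a where "a = (\<lambda>x::nat. eh (real x ^ 2 / real N))"
  \<comment> \<open>Half the phase increment from \<open>x\<close> to \<open>x + 1\<close>. Stopping
    at \<open>K\<close>, half the modulus, keeps it below \<open>pi / 2\<close>, where the cotangent
    is positive and decreasing.\<close>
  define y where "y = (\<lambda>x::nat. pi * (2 * real x + 1) / (2 * real N))"
  have N: "N > 0" using assms \<open>M < K\<close> by simp
  have y0: "y x > 0" for x using N by (simp add: y_def)
  have y2: "y x < pi / 2" if "x < K" for x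
  proof -
    have "pi * (2 * real x + 1) < pi * real N" using that assms by (intro mult_strict_left_mono) auto
    then show ?thesis using N by (simp add: y_def field_simps)
  qed
  have ymono: "y x \<le> y (Suc x)" for x using N by (simp add: y_def divide_right_mono)
  \<comment> \<open>Writing \<open>a x\<close> as a difference times \<open>1 / (cis (2 * y x) - 1)\<close>, whose only varying part is a decreasing
    cotangent, prepares for Abel summation.\<close>
  have step: "a x = (a (Suc x) - a x) * (- 1 / 2 - \<i> / 2 * of_real (cot (y x)))" if "x < K" for x
  proof -
    have "a (Suc x) = a x * cis (2 * y x)"
      using N unfolding a_def eh_def y_def cis_mult
      by (intro arg_cong[where f = cis]) (simp add: field_simps power2_eq_square)
    then have "a (Suc x) - a x = a x * (cis (2 * y x) - 1)" by (simp add: algebra_simps)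
    moreover have "sin (y x) \<noteq> 0" using sin_gt_zero[of "y x"] y0[of x] y2[OF that] by simp
    note cis_double_minus_1_mult_cot[OF this]
    ultimately show ?thesis by (simp only: mult.assoc mult_1_right)
  qed
  have "(\<Sum>x = M..<K. a x) = (\<Sum>x = M..<K. (a (Suc x) - a x) * (- 1 / 2 - \<i> / 2 * of_real (cot (y x))))"
    by (rule sum.cong[OF refl], rule step) simp
  \<comment> \<open>The constant part of the weight telescopes to the end values; only the cotangent
    part needs Abel summation.\<close>
  also have "\<dots> = (\<Sum>x = M..<K. (- 1 / 2) * (a (Suc x) - a x) -
      \<i> / 2 * ((a (Suc x) - a x) * of_real (cot (y x))))"
    by (simp add: algebra_simps add_divide_distrib diff_divide_distrib)
  also have "\<dots> = (- 1 / 2) * (\<Sum>x = M..<K. a (Suc x) - a x)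
      - \<i> / 2 * (\<Sum>x = M..<K. (a (Suc x) - a x) * of_real (cot (y x)))"
    by (simp only: sum_subtractf[symmetric] sum_distrib_left)
  also have "(\<Sum>x = M..<K. a (Suc x) - a x) = a K - a M"
    using assms by (intro sum_Suc_diff') auto
  also have "norm ((- 1 / 2) * (a K - a M) - \<i> / 2 * (\<Sum>x = M..<K. (a (Suc x) - a x) * of_real (cot (y x))))
      \<le> 1 + cot (y M)"
  proof (rule order.trans[OF norm_triangle_ineq4] add_mono)+
    have "norm (a K - a M) \<le> 2"
      using norm_triangle_ineq4[of "a K" "a M"] by (simp add: a_def)
    then show "norm ((- 1 / 2) * (a K - a M)) \<le> 1"
      by (simp only: norm_mult) simp
    have "norm (\<Sum>x = M..<K. (a (Suc x) - a x) * of_real (cot (y x))) \<le> 2 * cot (y M)"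
      using \<open>M < K\<close> y0 y2 ymono
      by (intro norm_sum_diff_mult_antimono)
         (auto simp: a_def intro!: cot_antimono less_imp_le[OF cot_gt_zero])
    then show "norm (\<i> / 2 * (\<Sum>x = M..<K. (a (Suc x) - a x) * of_real (cot (y x)))) \<le> cot (y M)"
      by (simp only: norm_mult) simp
  qed
  also have "cot (y M) \<le> 1 / y M"
    using y0 y2 \<open>M < K\<close> by (intro cot_le_inverse) auto
  also have "1 / y M \<le> real N / real M"
  proof -
    have "2 * real M \<le> pi * (2 * real M + 1)"
      using pi_ge_two by (intro order.trans[OF _ mult_mono[of 1 pi "2 * real M" "2 * real M + 1"]]) auto
    then have "2 * real N / (pi * (2 * real M + 1)) \<le> 2 * real N / (2 * real M)"
      using assms by (intro divide_left_mono) auto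
    then show ?thesis by (simp add: y_def)
  qed
  finally show ?thesis by (simp add: a_def)
qed simp

lemma gauss_sum_1_nat: "gauss_sum 1 (int N) = (\<Sum>x<N. eh (real x ^ 2 / real N))"
  unfolding gauss_sum_def
  by (rule sum.reindex_bij_witness[of _ int nat]) auto

text \<open>For even \<open>N\<close> the reflection of \<open>x\<close> to \<open>N - x\<close>
  preserves the terms, so the sum is twice its first half up to end terms.\<close>

lemma norm_gauss_sum_minus_initial:
  assumes "0 < M" "M \<le> K" "N = 2 * K"
  shows "norm (gauss_sum 1 (int N) - 2 * (\<Sum>x<M. eh (real x ^ 2 / real N))) \<le> 4 + 2 * real N / real M"
proof -
  define a where "a = (\<lambda>x::nat. eh (real x ^ 2 / real N))"
  have refl: "a (N - x) = a x" if "x \<le> N" "N > 0" for x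
  proof -
    have "real (N - x) ^ 2 / real N = real x ^ 2 / real N + 2 * of_int (int K - int x)"
      using that assms by (simp add: of_nat_diff field_simps power2_eq_square)
    then show ?thesis by (simp only: a_def eh_add_even)
  qed
  have N: "N > 0" using assms by simp
  have "gauss_sum 1 (int N) = (\<Sum>x<N. a x)" by (simp add: gauss_sum_1_nat a_def)
  also have "{..<N} = {..<K} \<union> {K..<N}" using assms by auto
  also have "(\<Sum>x\<in>\<dots>. a x) = (\<Sum>x<K. a x) + (\<Sum>x = K..<N. a x)"
    by (rule sum.union_disjoint) auto
  \<comment> \<open>The image is \<open>1..K\<close>, not \<open>0..<K\<close>: the term at
    \<open>K\<close> is gained and the term 1 at zero is lost.\<close>
  also have "(\<Sum>x = K..<N. a x) = (\<Sum>x = 1..<Suc K. a x)"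
    by (rule sum.reindex_bij_witness[of _ "\<lambda>x. N - x" "\<lambda>x. N - x"]) (use assms N in \<open>auto simp: refl[unfolded assms(3)]\<close>)
  also have "\<dots> = (\<Sum>x<K. a x) + a K - 1"
  proof -
    have "{..<Suc K} = insert 0 {1..<Suc K}" by auto
    then have "(\<Sum>x<Suc K. a x) = a 0 + (\<Sum>x = 1..<Suc K. a x)" by simp
    then show ?thesis by (simp add: a_def)
  qed
  also have "(\<Sum>x<K. a x) = (\<Sum>x<M. a x) + (\<Sum>x = M..<K. a x)"
    using assms by (subst sum.union_disjoint[symmetric]) (auto intro: sum.cong simp: ivl_disj_un)
  finally have "gauss_sum 1 (int N) - 2 * (\<Sum>x<M. a x) = 2 * (\<Sum>x = M..<K. a x) + (a K - 1)"
    by simp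
  also have "norm \<dots> \<le> 2 * (1 + real N / real M) + 2"
  proof (rule norm_triangle_mono)
    show "norm (2 * (\<Sum>x = M..<K. a x)) \<le> 2 * (1 + real N / real M)"
      using norm_quadratic_sum_tail[OF assms] by (simp add: norm_mult a_def)
    show "norm (a K - 1) \<le> 2"
      using norm_triangle_ineq4[of "a K" 1] by (simp add: a_def)
  qed
  finally show ?thesis by (simp add: a_def)
qed

section \<open>Stability under a perturbation of the modulus\<close>

lemma norm_eh_diff: "norm (eh s - eh t) \<le> pi * \<bar>s - t\<bar>"
proof -
  have "eh s - eh t = eh t * (cis (pi * (s - t)) - 1)"
    by (simp add: eh_def cis_mult algebra_simps)
  then have "norm (eh s - eh t) = norm (exp (\<i> * of_real (pi * (s - t))) - 1)"
    by (simp add: norm_mult cis_conv_exp)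
  also have "\<dots> \<le> \<bar>pi * (s - t)\<bar>"
    using dist_exp_i_1[of "pi * (s - t)"] abs_sin_x_le_abs_x[of "pi * (s - t) / 2"] by (simp add: dist_norm)
  finally show ?thesis by (simp add: abs_mult)
qed

lemma norm_quadratic_sum_diff:
  "norm ((\<Sum>x<M. eh (real x ^ 2 / A)) - (\<Sum>x<M. eh (real x ^ 2 / B))) \<le> pi * real M ^ 3 * \<bar>1 / A - 1 / B\<bar>"
proof -
  have "norm ((\<Sum>x<M. eh (real x ^ 2 / A)) - (\<Sum>x<M. eh (real x ^ 2 / B)))
      \<le> (\<Sum>x<M. pi * (real M ^ 2 * \<bar>1 / A - 1 / B\<bar>))"
    unfolding sum_subtractf[symmetric]
  proof (rule sum_norm_le)
    fix x assume "x \<in> {..<M}"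
    then have "real x ^ 2 \<le> real M ^ 2" by (intro power_mono) auto
    then have "\<bar>real x ^ 2 / A - real x ^ 2 / B\<bar> \<le> real M ^ 2 * \<bar>1 / A - 1 / B\<bar>"
      using abs_mult[of "real x ^ 2" "1 / A - 1 / B"]
      by (simp add: right_diff_distrib mult_right_mono)
    then show "norm (eh (real x ^ 2 / A) - eh (real x ^ 2 / B)) \<le> pi * (real M ^ 2 * \<bar>1 / A - 1 / B\<bar>)"
      using norm_eh_diff[of "real x ^ 2 / A" "real x ^ 2 / B"] pi_gt_zero
      by (meson mult_left_mono order.trans less_imp_le)
  qed
  then show ?thesis by (simp add: power_numeral_reduce mult_ac)
qed

section \<open>Evaluation and reciprocity\<close>

lemma gauss_sum_1_2: "gauss_sum 1 2 = 1 + \<i>"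
proof -
  have "{0..<2::int} = {0, 1}" by auto
  then show ?thesis by (simp add: gauss_sum_def eh_def)
qed

text \<open>The sums of moduli \<open>n * r\<^sup>2\<close> and \<open>2 * r'\<^sup>2\<close> are
  compared through equally many initial terms: two truncation errors and one perturbation
  error.\<close>

lemma norm_gauss_sum_compare:
  assumes n: "even n" "n > 0" and r: "r > 0" "r' > 0" and M: "M > 0" "2 * M \<le> n * r\<^sup>2" "M \<le> r'\<^sup>2"
    and AB: "A = real n * real r ^ 2" "B = 2 * real r' ^ 2"
  shows "norm (of_nat r * gauss_sum 1 (int n) - of_nat r' * (1 + \<i>))
    \<le> 8 + 2 * (A + B) / real M + 2 * (pi * real M ^ 3 * \<bar>1 / A - 1 / B\<bar>)"
proof -
  define SA SB where "SA = (\<Sum>x<M. eh (real x ^ 2 / A))" and "SB = (\<Sum>x<M. eh (real x ^ 2 / B))"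
  define TA TB where "TA = of_nat r * gauss_sum 1 (int n)" and "TB = of_nat r' * (1 + \<i>)"
  have "norm (TA - 2 * SA) \<le> 4 + 2 * A / real M"
  proof -
    have "TA = gauss_sum 1 (int (n * r\<^sup>2))"
      using gauss_sum_square_mult[of "int n" "int r"] n r by (simp add: TA_def)
    moreover have "n * r\<^sup>2 = 2 * (n * r\<^sup>2 div 2)" using n by simp
    ultimately show ?thesis
      using norm_gauss_sum_minus_initial[of M "n * r\<^sup>2 div 2" "n * r\<^sup>2"] M by (simp add: SA_def AB)
  qed
  moreover have "norm (TB - 2 * SB) \<le> 4 + 2 * B / real M"
  proof -
    have "TB = gauss_sum 1 (int (2 * r'\<^sup>2))"
      using gauss_sum_square_mult[of 2 "int r'"] r by (simp add: TB_def gauss_sum_1_2)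
    then show ?thesis
      using norm_gauss_sum_minus_initial[of M "r'\<^sup>2" "2 * r'\<^sup>2"] M by (simp add: SB_def AB)
  qed
  moreover have "norm (2 * (SA - SB)) \<le> 2 * (pi * real M ^ 3 * \<bar>1 / A - 1 / B\<bar>)"
  proof -
    have "norm (2 * (SA - SB)) = 2 * norm (SA - SB)" by (simp only: norm_mult) simp
    then show ?thesis using norm_quadratic_sum_diff[of A M B] by (simp add: SA_def SB_def)
  qed
  moreover have "TA - TB = (TA - 2 * SA) - (TB - 2 * SB) + 2 * (SA - SB)"
    by simp
  then have "norm (TA - TB) \<le> norm (TA - 2 * SA) + norm (TB - 2 * SB) + norm (2 * (SA - SB))"
    by (metis norm_triangle_mono norm_triangle_ineq4 order_refl)
  ultimately show ?thesis
    by (simp add: TA_def TB_def add_divide_distrib algebra_simps)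
qed

lemma gauss_sum_1_even:
  assumes n: "even n" "n > 0"
  shows "gauss_sum 1 (int n) = of_real (sqrt (real n)) * cis (pi / 4)"
proof -
  \<comment> \<open>Then \<open>n * r\<^sup>2 = 2 * (r * \<rho>)\<^sup>2\<close>, so rounding
    \<open>r * \<rho>\<close> down gives \<open>r'\<close>, and the target value is
    \<open>\<rho> * (1 + \<i>)\<close>.\<close>
  define \<rho> where "\<rho> = sqrt (real n / 2)"
  define T where "T = gauss_sum 1 (int n)"
  have n2: "n \<ge> 2" using n by (cases n) (auto elim: oddE)
  have \<rho>: "\<rho> \<ge> 1" "real n = 2 * \<rho>\<^sup>2" using n2 by (simp_all add: \<rho>_def)
  have bound: "real t * norm (T - of_real \<rho> * (1 + \<i>)) \<le> 10 + 4 * real n + 8 * \<rho>" if t: "t > 0" for t :: nat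
  proof -
    \<comment> \<open>The truncation error is \<open>O(r\<^sup>2/M) = O(t\<^sup>3)\<close> and the perturbation error is \<open>O(M\<^sup>3/r\<^sup>3) = O(t\<^sup>3)\<close>;
      both are \<open>o(r)\<close>.\<close>
    define r M where "r = t ^ 4" and "M = t ^ 5"
    define r' where "r' = nat \<lfloor>real r * \<rho>\<rfloor>"
    define A B where "A = real n * real r ^ 2" and "B = 2 * real r' ^ 2"
    have r: "r > 0" "M > 0" using t by (simp_all add: r_def M_def)
    have rr: "real r \<le> real r * \<rho>" using mult_left_mono[OF \<rho>(1), of "real r"] by simp
    have r': "real r' \<le> real r * \<rho>" "real r * \<rho> - 1 \<le> real r'"
      using rr r by (simp_all add: r'_def)
    have "r \<le> r'" using rr by (simp add: r'_def le_nat_iff le_floor_iff)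
    then have r'0: "r' > 0" and r_le: "real r \<le> real r'" using r by simp_all
    \<comment> \<open>As \<open>t ^ 8\<close> is \<open>r\<^sup>2\<close>, this keeps the cut-off
      \<open>M\<close> within the first half of both moduli.\<close>
    have "t ^ 5 \<le> t ^ 8" using t by (intro power_increasing) auto
    then have Mr: "M \<le> r\<^sup>2" by (simp add: M_def r_def flip: power_mult)
    have "2 * M \<le> n * r\<^sup>2" using mult_mono[OF n2 Mr] by simp
    moreover have "M \<le> r'\<^sup>2" using order.trans[OF Mr power_mono[OF \<open>r \<le> r'\<close> zero_le]] .
    ultimately have cmp: "norm (of_nat r * T - of_nat r' * (1 + \<i>))
        \<le> 8 + 2 * (A + B) / real M + 2 * (pi * real M ^ 3 * \<bar>1 / A - 1 / B\<bar>)"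
      unfolding T_def using n r r'0 by (intro norm_gauss_sum_compare) (simp_all add: A_def B_def)
    have A: "A = 2 * (real r * \<rho>)\<^sup>2" by (simp add: A_def \<rho> power_mult_distrib)
    have BA: "B \<le> A" unfolding A B_def using r' by (simp add: power_mono)
    have B2: "2 * real r ^ 2 \<le> B" unfolding B_def using r_le by (simp add: power_mono)
    have B0: "B > 0" using r'0 by (simp add: B_def)
    have A0: "A > 0" using B0 BA by simp
    have AB: "A - B \<le> 4 * \<rho> * real r"
    proof -
      \<comment> \<open>Rounding costs at most 1, so the difference of squares is only linear in
        \<open>r\<close>.\<close>
      have "A - B = 2 * ((real r * \<rho> - real r') * (real r * \<rho> + real r'))"
        by (simp add: A B_def power2_eq_square algebra_simps)
      also have "\<dots> \<le> 2 * (1 * (real r * \<rho> + real r * \<rho>))"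
        using r' by (intro mult_left_mono mult_mono add_mono) (auto simp: mult.commute)
      finally show ?thesis by (simp only: mult_ac) simp
    qed
    have "\<bar>1 / A - 1 / B\<bar> = (A - B) / (A * B)"
      using A0 B0 BA by (simp add: field_simps abs_if)
    also have "\<dots> \<le> (4 * \<rho> * real r) / ((2 * real r ^ 2) * (2 * real r ^ 2))"
      using AB BA B2 r \<rho> A0 B0 by (intro frac_le mult_mono) auto
    also have "\<dots> = \<rho> / real r ^ 3"
      using r by (simp add: field_simps power_numeral_reduce)
    finally have "pi * real M ^ 3 * \<bar>1 / A - 1 / B\<bar> \<le> pi * real M ^ 3 * (\<rho> / real r ^ 3)"
      by (intro mult_left_mono) auto
    also have "\<dots> = pi * \<rho> * real t ^ 3"
      using t by (simp add: M_def r_def field_simps flip: power_mult power_add)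
    also have "\<dots> \<le> 4 * \<rho> * real t ^ 3"
      using pi_less_4 \<rho> by (intro mult_right_mono) auto
    finally have e2: "pi * real M ^ 3 * \<bar>1 / A - 1 / B\<bar> \<le> 4 * \<rho> * real t ^ 3" .
    have "2 * (A + B) / real M \<le> 4 * A / real M"
      using BA by (intro divide_right_mono) auto
    also have "\<dots> = 4 * real n * real t ^ 3"
      using t by (simp add: A_def M_def r_def field_simps flip: power_mult power_add)
    finally have e1: "2 * (A + B) / real M \<le> 4 * real n * real t ^ 3" .
    have e0: "norm (of_real (real r' - real r * \<rho>) * (1 + \<i>)) \<le> 2"
    proof -
      have "norm (1 + \<i>) \<le> 2" using norm_triangle_ineq[of 1 \<i>] by simp
      then have "\<bar>real r' - real r * \<rho>\<bar> * norm (1 + \<i>) \<le> 1 * 2"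
        using r' by (intro mult_mono) auto
      then show ?thesis by (simp only: norm_mult norm_of_real)
    qed
    have "real r * norm (T - of_real \<rho> * (1 + \<i>)) = norm (of_nat r * (T - of_real \<rho> * (1 + \<i>)))"
      by (simp add: norm_mult)
    also have "of_nat r * (T - of_real \<rho> * (1 + \<i>)) =
        (of_nat r * T - of_nat r' * (1 + \<i>)) + of_real (real r' - real r * \<rho>) * (1 + \<i>)"
      by (simp add: algebra_simps)
    also have "norm \<dots> \<le> (8 + 4 * real n * real t ^ 3 + 2 * (4 * \<rho> * real t ^ 3)) + 2"
      using cmp e1 e2 by (intro norm_triangle_mono e0) linarith
    also have "\<dots> \<le> real t ^ 3 * (10 + 4 * real n + 8 * \<rho>)"
      using t one_le_power[of "real t" 3] by (simp add: algebra_simps)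
    \<comment> \<open>Since \<open>r = t ^ 4\<close>, cancelling \<open>t ^ 3\<close> leaves one
      factor \<open>t\<close> against a bound independent of \<open>t\<close>.\<close>
    finally have "real t ^ 3 * (real t * norm (T - of_real \<rho> * (1 + \<i>))) \<le> real t ^ 3 * (10 + 4 * real n + 8 * \<rho>)"
      by (simp add: r_def power_numeral_reduce mult_ac)
    then show ?thesis using t by simp
  qed
  have "T = of_real \<rho> * (1 + \<i>)"
  proof (rule ccontr)
    assume "T \<noteq> of_real \<rho> * (1 + \<i>)"
    then have pos: "norm (T - of_real \<rho> * (1 + \<i>)) > 0" by simp
    from reals_Archimedean3[OF this, THEN spec, of "10 + 4 * real n + 8 * \<rho>"]
    obtain t :: nat where t: "10 + 4 * real n + 8 * \<rho> < real t * norm (T - of_real \<rho> * (1 + \<i>))"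
      by blast
    moreover have "t > 0" using t \<rho> by (cases t) auto
    ultimately show False using bound[of t] by simp
  qed
  also have "\<dots> = of_real (sqrt (real n)) * cis (pi / 4)"
    by (simp add: \<rho>_def complex_eq_iff cos_45 sin_45 real_sqrt_divide field_simps)
  finally show ?thesis by (simp add: T_def)
qed

lemma gauss_sum_reciprocity:
  assumes "p > 0" "q > 0" "coprime p q" "even (p * q)"
  shows "gauss_sum p q = cis (pi / 4) * of_real (sqrt (of_int q / of_int p)) * cnj (gauss_sum q p)"
proof -
  have pq: "gauss_sum 1 (p * q) = of_real (sqrt (of_int (p * q))) * cis (pi / 4)"
    using gauss_sum_1_even[of "nat (p * q)"] assms by (simp add: even_nat_iff)
  \<comment> \<open>Writing \<open>p\<close> as S(q,p) times its conjugate produces the product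
    S(p,q) S(q,p) = S(1,pq).\<close>
  have "gauss_sum p q * of_int p = gauss_sum p q * (gauss_sum q p * cnj (gauss_sum q p))"
    by (subst gauss_sum_mult_cnj) (use assms in \<open>auto simp: coprime_commute\<close>)
  also have "\<dots> = gauss_sum 1 (p * q) * cnj (gauss_sum q p)"
    using gauss_sum_mult_coprime[of p q 1] assms by (simp add: mult_ac)
  also have "\<dots> = cis (pi / 4) * of_real (sqrt (of_int (p * q))) * cnj (gauss_sum q p)"
    by (simp add: pq)
  also have "sqrt (of_int (p * q)) = sqrt (of_int q / of_int p) * of_int p"
  proof -
    have "sqrt (of_int p) * sqrt (of_int p) = (of_int p :: real)" using assms by simp
    then show ?thesis using assms by (simp add: real_sqrt_mult real_sqrt_divide field_simps)
  qed
  finally show ?thesis using assms by simp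
qed

text \<open>Common factors are cancelled to reach coprime arguments; if both reduced arguments are
  odd, both sides vanish.\<close>

lemma U_reciprocity:
  assumes "p > 0" "q > 0"
  shows "U p q = cis (pi / 4) * of_real (sqrt (of_int p / of_int q)) * cnj (U q p)"
proof -
  define g where "g = gcd p q"
  define a b where "a = p div g" and "b = q div g"
  have g: "g > 0" using assms by (simp add: g_def)
  have pq: "p = a * g" "q = b * g" by (simp_all add: a_def b_def g_def)
  have ab: "a > 0" "b > 0" using assms g pq by (auto simp: zero_less_mult_iff)
  have cop: "coprime a b" unfolding a_def b_def g_def using assms by (intro div_gcd_coprime) auto
  have "U a b = cis (pi / 4) * of_real (sqrt (of_int a / of_int b)) * cnj (U b a)"
  proof (cases "even (a * b)")
    case True
    \<comment> \<open>Passing from Gauss sums to \<open>U\<close> divides by \<open>b\<close> on one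
      side and by \<open>a\<close> on the other, which inverts the ratio under the root.\<close>
    have "sqrt (of_int b / of_int a) / of_int b = sqrt (of_int a / of_int b) / (of_int a :: real)"
    proof -
      have "sqrt (of_int a) * sqrt (of_int a) = (of_int a :: real)" "sqrt (of_int b) * sqrt (of_int b) = (of_int b :: real)"
        using ab by simp_all
      then show ?thesis using ab by (simp add: real_sqrt_divide field_simps)
    qed
    from arg_cong[OF this, of complex_of_real]
    have sq: "of_real (sqrt (of_int b / of_int a)) / of_int b = (of_real (sqrt (of_int a / of_int b)) / of_int a :: complex)"
      by simp
    have "U a b = gauss_sum a b / of_int b" using ab True by (simp add: U_eq_gauss_sum)
    also have "\<dots> = cis (pi / 4) * (of_real (sqrt (of_int b / of_int a)) / of_int b) * cnj (gauss_sum b a)"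
      unfolding gauss_sum_reciprocity[OF ab cop True] by simp
    also have "\<dots> = cis (pi / 4) * of_real (sqrt (of_int a / of_int b)) * (cnj (gauss_sum b a) / of_int a)"
      unfolding sq by simp
    also have "cnj (gauss_sum b a) / of_int a = cnj (U b a)"
      using ab True by (simp add: U_eq_gauss_sum mult.commute)
    finally show ?thesis .
  next
    case False
    then show ?thesis using ab by (simp add: U_odd mult.commute[of b a])
  qed
  then show ?thesis
    using g ab by (simp add: pq U_mult_right)
qed

section \<open>Functional equation and Euler product\<close>

lemma u_of_nat_divide: "q > 0 \<Longrightarrow> u (of_nat p / of_nat q) = U (int p) (int q)"
  using u_of_int_divide[of "int q" "int p"] by simp

lemma of_nat_powr: "d > 0 \<Longrightarrow> (of_nat d :: complex) powr s = exp (s * of_real (ln (real d)))"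
  by (simp add: powr_def)

text \<open>The root is the factor from reciprocity; it is what exchanges \<open>a\<close> with
  \<open>b\<close> when \<open>1 - s\<close> is replaced by \<open>s\<close>.\<close>

lemma powr_functional_factor:
  assumes "a > 0" "b > 0"
  shows "(of_nat (a * b) :: complex) powr (- (1 - s) / 2) * (of_real (sqrt (real b / real a)) * of_nat a powr (1 - s))
    = of_nat (a * b) powr (- s / 2) * of_nat b powr s"
proof -
  have "sqrt (real b / real a) = exp ((ln (real b) - ln (real a)) / 2)"
    using assms by (intro real_sqrt_unique) (simp_all add: exp_diff power2_eq_square flip: exp_add)
  then have "(of_real (sqrt (real b / real a)) :: complex) = exp ((of_real (ln (real b)) - of_real (ln (real a))) / 2)"
    by (simp flip: exp_of_real)
  then show ?thesis
    using assms by (simp add: of_nat_powr ln_mult del: of_nat_mult flip: exp_add)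
      (simp add: of_nat_mult ln_mult algebra_simps add_divide_distrib diff_divide_distrib)
qed

lemma L_functional_equation:
  assumes n: "n > 0"
  shows "L n (1 - s) = cis (pi / 4) * cnj (L n (cnj s))"
proof -
  let ?D = "{(d1, d2). d1 * d2 = n \<and> d1 > 0 \<and> d2 > 0}"
  let ?t = "\<lambda>s d1 d2. u (of_nat d2 / of_nat d1) * (of_nat d1 powr s / of_real (sqrt (of_nat (gcd d1 d2))))"
  have "of_nat n powr (- (1 - s) / 2) * ?t (1 - s) a b =
      cis (pi / 4) * cnj (of_nat n powr (- cnj s / 2) * ?t (cnj s) b a)" if ab: "a * b = n" "a > 0" "b > 0" for a b
  proof -
    have cp: "cnj (of_nat m powr z) = of_nat m powr (cnj z)" for m z
      by (simp add: cnj_powr)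
    have "of_nat n powr (- (1 - s) / 2) * ?t (1 - s) a b =
        cis (pi / 4) * cnj (U (int a) (int b)) / of_real (sqrt (of_nat (gcd a b))) *
        (of_nat n powr (- (1 - s) / 2) * (of_real (sqrt (real b / real a)) * of_nat a powr (1 - s)))"
      using ab U_reciprocity[of "int b" "int a"] by (simp add: u_of_nat_divide)
    also have "\<dots> = cis (pi / 4) * cnj (U (int a) (int b)) / of_real (sqrt (of_nat (gcd a b))) *
        (of_nat n powr (- s / 2) * of_nat b powr s)"
      using powr_functional_factor[OF ab(2,3), of s] unfolding ab(1) by simp
    also have "\<dots> = cis (pi / 4) * cnj (of_nat n powr (- cnj s / 2) * ?t (cnj s) b a)"
      using ab by (simp add: cp u_of_nat_divide gcd.commute)
    finally show ?thesis .
  qed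
  then have "(\<Sum>(a, b)\<in>?D. of_nat n powr (- (1 - s) / 2) * ?t (1 - s) a b) =
      (\<Sum>(a, b)\<in>?D. cis (pi / 4) * cnj (of_nat n powr (- cnj s / 2) * ?t (cnj s) b a))"
    by (intro sum.cong) auto
  also have "\<dots> = (\<Sum>(a, b)\<in>?D. cis (pi / 4) * cnj (of_nat n powr (- cnj s / 2) * ?t (cnj s) a b))"
    by (rule sum.reindex_bij_witness[of _ prod.swap prod.swap]) auto
  finally show ?thesis
    unfolding L_def Z_def cnj_sum complex_cnj_mult case_prod_unfold sum_distrib_left
    by (simp add: mult.assoc)
qed

text \<open>Each divisor of \<open>a * b\<close> is uniquely \<open>x * y\<close>, and its gcds with
  \<open>a\<close> and \<open>b\<close> recover the factors.\<close>

lemma sum_divisors_coprime_mult: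
  fixes G :: "nat \<Rightarrow> 'a::comm_semiring_0"
  assumes "coprime a b" and G: "\<And>x y. x dvd a \<Longrightarrow> y dvd b \<Longrightarrow> G (x * y) = G x * G y"
  shows "(\<Sum>d | d dvd a * b. G d) = (\<Sum>d | d dvd a. G d) * (\<Sum>d | d dvd b. G d)"
proof -
  have *: "gcd (x * y) a = x" "gcd (x * y) b = y" if "x dvd a" "y dvd b" for x y
  proof -
    have "coprime b x" "coprime a y"
      using coprime_divisors[OF that(1) dvd_refl assms(1)] coprime_divisors[OF dvd_refl that(2) assms(1)]
      by (simp_all add: coprime_commute)
    then show "gcd (x * y) a = x" "gcd (x * y) b = y"
      using that by (simp_all add: gcd_mult_left_right_cancel gcd_mult_left_left_cancel gcd_proj1_if_dvd)
  qed
  have "(\<Sum>d | d dvd a * b. G d) = (\<Sum>(x, y)\<in>{d. d dvd a} \<times> {d. d dvd b}. G x * G y)"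
  proof (rule sum.reindex_bij_witness[of _ "\<lambda>(x, y). x * y" "\<lambda>d. (gcd d a, gcd d b)"])
    fix d assume "d \<in> {d. d dvd a * b}"
    then obtain x y where xy: "d = x * y" "x dvd a" "y dvd b"
      using division_decomp[of d a b] by auto
    show "(case (gcd d a, gcd d b) of (x, y) \<Rightarrow> x * y) = d"
      and "(case (gcd d a, gcd d b) of (x, y) \<Rightarrow> G x * G y) = G d"
      using xy by (simp_all add: * G)
    show "(gcd d a, gcd d b) \<in> {d. d dvd a} \<times> {d. d dvd b}" by simp
  qed (auto simp: * mult_dvd_mono)
  then show ?thesis by (simp add: sum_product sum.cartesian_product)
qed

text \<open>Strong induction removes one full prime power at a time. Multiplicativity is asked only
  among divisors of \<open>n\<close>, as the intended summand depends on \<open>n\<close>; the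
  condition passes to the cofactor.\<close>

lemma sum_divisors_eq_prod_primes:
  fixes G :: "nat \<Rightarrow> 'a::comm_semiring_1"
  assumes "n > 0" "G 1 = 1"
    and G: "\<And>a b. coprime a b \<Longrightarrow> a * b dvd n \<Longrightarrow> G (a * b) = G a * G b"
  shows "(\<Sum>d | d dvd n. G d) = (\<Prod>p | prime p \<and> p dvd n. \<Sum>k = 0..multiplicity p n. G (p ^ k))"
  using assms(1) G
proof (induction n rule: less_induct)
  case (less n)
  show ?case
  proof (cases "n = 1")
    case True
    then show ?thesis using assms(2) by simp
  next
    case False
    then obtain p where p: "prime p" "p dvd n" using prime_factor_nat by blast
    define \<alpha> where "\<alpha> = multiplicity p n"
    obtain m where m: "n = p ^ \<alpha> * m" "\<not> p dvd m"
      using p less.prems(1) unfolding \<alpha>_def by (metis multiplicity_decompose' not_prime_unit less_nat_zero_code)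
    have \<alpha>: "\<alpha> > 0" using m p by (cases \<alpha>) auto
    have pw: "q dvd p ^ \<alpha> \<longleftrightarrow> q = p" if "prime q" for q
      using that p(1) \<alpha> by (auto simp: prime_dvd_power_iff intro: primes_dvd_imp_eq)
    have m0: "m > 0" using m less.prems(1) by (cases m) auto
    have cop: "coprime (p ^ \<alpha>) m" using p m by (simp add: prime_imp_coprime)
    have "1 < p ^ \<alpha>" using prime_gt_1_nat[OF p(1)] \<alpha> by (rule one_less_power)
    then have "m < n" using m m0 by simp
    then have IH: "(\<Sum>d | d dvd m. G d) = (\<Prod>p | prime p \<and> p dvd m. \<Sum>k = 0..multiplicity p m. G (p ^ k))"
      using m m0 less.prems(2) by (intro less.IH) (auto simp: dvd_mult)
    have "(\<Sum>d | d dvd n. G d) = (\<Sum>d | d dvd p ^ \<alpha>. G d) * (\<Sum>d | d dvd m. G d)"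
      unfolding m(1)
    proof (rule sum_divisors_coprime_mult[OF cop])
      fix x y assume xy: "x dvd p ^ \<alpha>" "y dvd m"
      show "G (x * y) = G x * G y"
        using coprime_divisors[OF xy cop] mult_dvd_mono[OF xy] unfolding m(1)[symmetric]
        by (rule less.prems(2))
    qed
    also have "(\<Sum>d | d dvd p ^ \<alpha>. G d) = (\<Sum>k = 0..\<alpha>. G (p ^ k))"
    proof -
      have "{d. d dvd p ^ \<alpha>} = (\<lambda>k. p ^ k) ` {0..\<alpha>}"
        using p by (auto simp: divides_primepow_nat)
      moreover have "inj_on (\<lambda>k. p ^ k) {0..\<alpha>}"
        using p by (auto intro!: inj_onI simp: prime_power_inj)
      ultimately show ?thesis by (simp add: sum.reindex)
    qed
    also have "(\<Sum>d | d dvd m. G d) = (\<Prod>q | prime q \<and> q dvd m. \<Sum>k = 0..multiplicity q n. G (q ^ k))"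
      unfolding IH
    proof (intro prod.cong refl)
      fix q assume "q \<in> {q. prime q \<and> q dvd m}"
      then have "prime q" "\<not> q dvd p ^ \<alpha>"
        using m by (auto simp: pw)
      then show "(\<Sum>k = 0..multiplicity q m. G (q ^ k)) = (\<Sum>k = 0..multiplicity q n. G (q ^ k))"
        by (simp add: m(1) multiplicity_prime_elem_times_other)
    qed
    also have "(\<Sum>k = 0..\<alpha>. G (p ^ k)) * \<dots> =
        (\<Prod>q\<in>insert p {q. prime q \<and> q dvd m}. \<Sum>k = 0..multiplicity q n. G (q ^ k))"
      using m m0 finite_prime_divisors[of m] by (subst prod.insert) (auto simp: \<alpha>_def)
    also have "insert p {q. prime q \<and> q dvd m} = {q. prime q \<and> q dvd n}"
      using p by (auto simp: m(1) prime_dvd_mult_iff pw)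
    finally show ?thesis .
  qed
qed

text \<open>The summand as a function of the first divisor alone, so that multiplicativity can be
  stated; \<open>n\<close> stays fixed, also in the local factors.\<close>

definition Z_term :: "nat \<Rightarrow> complex \<Rightarrow> nat \<Rightarrow> complex" where
  "Z_term n s d = u (of_nat (n div d) / of_nat d) *
     (of_nat d powr s / of_real (sqrt (of_nat (gcd d (n div d)))))"

lemma Z_eq_sum_Z_term: "n > 0 \<Longrightarrow> Z n s = (\<Sum>d | d dvd n. Z_term n s d)"
  unfolding Z_def Z_term_def
  by (rule sum.reindex_bij_witness[of _ "\<lambda>d. (d, n div d)" fst]) (auto elim!: dvdE)

lemma Z_local_eq_sum_Z_term:
  assumes "prime p"
  shows "Z_local n p s = (\<Sum>k = 0..multiplicity p n. Z_term n s (p ^ k))"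
proof -
  have "of_nat (p ^ k) powr s = of_nat p powr (of_nat k * s)" for k
    using of_nat_powr[of "p ^ k" s] of_nat_powr[of p "of_nat k * s"] assms
    by (simp add: prime_gt_0_nat ln_realpow mult_ac)
  then show ?thesis by (simp add: Z_local_def Z_term_def)
qed

lemma Z_term_1: "even n \<Longrightarrow> Z_term n s 1 = 1"
  using u_of_nat_divide[of 1 n] by (simp add: Z_term_def U_1)

lemma gcd_mult_left_coprime:
  fixes a b m :: nat
  assumes "coprime a b"
  shows "gcd (a * b) m = gcd a m * gcd b m"
proof (rule dvd_antisym)
  obtain x y where xy: "gcd (a * b) m = x * y" "x dvd a" "y dvd b"
    using division_decomp[of "gcd (a * b) m" a b] by auto
  then have "x dvd m" "y dvd m"
    by (metis gcd_dvd2 dvd_mult_left, metis gcd_dvd2 dvd_mult_right)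
  then show "gcd (a * b) m dvd gcd a m * gcd b m"
    using xy by (simp add: mult_dvd_mono)
  have "coprime (gcd a m) (gcd b m)"
    using assms by (rule coprime_divisors[rotated 2]) auto
  then show "gcd a m * gcd b m dvd gcd (a * b) m"
    by (auto intro!: divides_mult gcd_greatest mult_dvd_mono)
qed

text \<open>With \<open>n = a * b * m\<close> the fractions are \<open>m / (a * b)\<close>,
  \<open>b * m / a\<close> and \<open>a * m / b\<close>, as in
  \<open>gauss_sum_mult_coprime\<close>; each parity condition says that \<open>n\<close> is
  even.\<close>

lemma Z_term_mult:
  assumes n: "n > 0" "even n" and ab: "coprime a b" "a * b dvd n"
  shows "Z_term n s (a * b) = Z_term n s a * Z_term n s b"
proof -
  obtain m where m: "n = a * b * m" using ab by auto
  have pos: "a > 0" "b > 0" "m > 0" using n m by auto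
  have div: "n div (a * b) = m" "n div a = b * m" "n div b = a * m"
    using pos by (auto simp: m)
  have "gcd (a * b) m = gcd a m * gcd b m"
    by (rule gcd_mult_left_coprime[OF ab(1)])
  then have g: "gcd (a * b) m = gcd a (b * m) * gcd b (a * m)"
    using ab by (simp add: gcd_mult_right_left_cancel coprime_commute)
  have ev: "even (int m * int a * int b)"
    using n by (simp add: m mult_ac)
  have "U (int m) (int (a * b)) = U (int (b * m)) (int a) * U (int (a * m)) (int b)"
    using gauss_sum_mult_coprime[of "int a" "int b" "int m"] pos ab ev
      U_eq_gauss_sum[of "int (a * b)" "int m"] U_eq_gauss_sum[of "int a" "int (b * m)"]
      U_eq_gauss_sum[of "int b" "int (a * m)"]
    by (simp add: mult_ac disj_ac)
  moreover have "(of_nat (a * b) :: complex) powr s = of_nat a powr s * of_nat b powr s"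
    using of_nat_powr[of "a * b" s] pos by (simp add: of_nat_powr ln_mult algebra_simps flip: exp_add)
  ultimately show ?thesis
    using pos unfolding Z_term_def div g
    by (simp add: u_of_nat_divide real_sqrt_mult del: of_nat_mult) (simp add: real_sqrt_mult mult_ac)
qed

lemma Z_eq_prod_Z_local:
  assumes "n > 0" "even n"
  shows "Z n s = (\<Prod>p \<in> {p. prime p \<and> p dvd n}. Z_local n p s)"
  unfolding Z_eq_sum_Z_term[OF assms(1)]
  using assms sum_divisors_eq_prod_primes[of n "Z_term n s"]
  by (simp add: Z_local_eq_sum_Z_term Z_term_1[simplified] Z_term_mult)

section \<open>Zeros of the local factors\<close>

text \<open>Multiplication by \<open>c\<close> permutes the residues modulo
  \<open>q\<close>.\<close>

lemma U_mult_square: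
  assumes "q > 0" "coprime c q" "even (p * q)"
  shows "U (p * c\<^sup>2) q = U p q"
proof -
  let ?f = "\<lambda>x. eh (of_int (p * x\<^sup>2) / of_int q)"
  have "gauss_sum (p * c\<^sup>2) q = (\<Sum>x = 0..<q. ?f (c * x))"
    by (simp add: gauss_sum_def power_mult_distrib mult_ac)
  also have "\<dots> = gauss_sum p q"
    unfolding gauss_sum_def
  proof (rule sum_complete_residues)
    show "inj_on (\<lambda>x. c * x mod q) {0..<q}"
    proof (rule inj_onI)
      fix x y assume *: "x \<in> {0..<q}" "y \<in> {0..<q}" "c * x mod q = c * y mod q"
      then have "q dvd c * (x - y)" by (simp add: mod_eq_dvd_iff right_diff_distrib)
      then have "q dvd x - y" using assms(2) by (simp add: coprime_dvd_mult_right_iff coprime_commute)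
      then show "x = y" using * by (intro eq_if_dvd_diff_bounded[of x q y]) auto
    qed
  qed (use assms in \<open>auto simp: eh_quadratic_mod simp del: of_int_mult\<close>)
  finally show ?thesis using assms by (auto simp: U_eq_gauss_sum)
qed

text \<open>The scaling that gives modulus 1 for coprime arguments with even product.\<close>

definition U_normalized :: "int \<Rightarrow> int \<Rightarrow> complex" where
  "U_normalized p q = of_real (sqrt (of_int q)) * U p q"

lemma norm_U_normalized:
  assumes "q > 0" "coprime p q" "even (p * q)"
  shows "norm (U_normalized p q) = 1"
proof -
  have "norm (gauss_sum p q) ^ 2 = of_int q"
    using arg_cong[OF gauss_sum_mult_cnj[OF assms], of norm] assms by (simp add: norm_mult power2_eq_square)
  then have "norm (gauss_sum p q) = sqrt (of_int q)"
    by (metis norm_ge_zero real_sqrt_abs abs_of_nonneg)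
  then show ?thesis
    using assms by (simp add: U_normalized_def U_eq_gauss_sum norm_mult norm_divide)
qed

text \<open>Reciprocity cancels the root of \<open>q\<close> and moves \<open>q\<close> into the
  numerator, where squares coprime to \<open>p\<close> are absorbed.\<close>

lemma U_normalized_mult_square:
  assumes "p > 0" "q > 0" "c > 0" "coprime c p" "even (p * q)"
  shows "U_normalized p (q * c\<^sup>2) = U_normalized p q"
proof -
  have *: "U_normalized p r = cis (pi / 4) * of_real (sqrt (of_int p)) * cnj (U r p)" if "r > 0" for r
    unfolding U_normalized_def using U_reciprocity[OF assms(1) that] that by (simp add: real_sqrt_divide)
  show ?thesis
    using assms U_mult_square[of p c q] by (simp add: * mult.commute[of q p])
qed

lemma U_normalized_prime_power:
  assumes "m > 0" "p > 0" "coprime p m" "even (m * p ^ j)"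
  shows "U_normalized m (p ^ (j + 2 * i)) = U_normalized m (p ^ j)"
proof (induction i)
  case (Suc i)
  have "U_normalized m (p ^ (j + 2 * i) * p\<^sup>2) = U_normalized m (p ^ (j + 2 * i))"
    using assms by (intro U_normalized_mult_square) (auto simp: power_add)
  then show ?case using Suc by (simp add: power_add power2_eq_square mult_ac)
qed simp

text \<open>In lowest terms \<open>n / p ^ (2 * k)\<close> is an integer or has denominator
  \<open>p ^ (2 * k - \<alpha>)\<close>. The shift by 1/2 in \<open>Y\<close> frees a factor
  \<open>sqrt p ^ k\<close>: it cancels the gcd root in the first case and leaves the normalizing
  root in the second.\<close>

lemma Z_term_prime_power:
  fixes s :: complex
  assumes p: "prime p" and n: "n = p ^ \<alpha> * m" "m > 0" "\<not> p dvd m" and k: "k \<le> \<alpha>"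
  defines "Y \<equiv> of_nat p powr (s - 1 / 2)"
  shows "Z_term n s (p ^ k) = (if 2 * k \<le> \<alpha> then U (int (p ^ (\<alpha> - 2 * k) * m)) 1
    else U_normalized (int m) (int p ^ (2 * k - \<alpha>))) * Y ^ k"
proof -
  have p0: "p > 0" using p prime_gt_0_nat by blast
  have div: "n div p ^ k = p ^ (\<alpha> - k) * m"
    using k p0 by (simp add: n(1) power_diff div_mult_swap le_imp_power_dvd mult.commute)
  have gcd: "gcd (p ^ k) (p ^ (\<alpha> - k) * m) = p ^ min k (\<alpha> - k)"
  proof -
    have "coprime (p ^ k) m" using p n(3) by (simp add: prime_imp_coprime)
    then have "gcd (p ^ k) (p ^ (\<alpha> - k) * m) = gcd (p ^ k) (p ^ (\<alpha> - k))"
      by (rule gcd_mult_right_right_cancel)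
    also have "\<dots> = p ^ min k (\<alpha> - k)"
      by (cases "k \<le> \<alpha> - k") (auto simp: min_def le_imp_power_dvd gcd_proj1_if_dvd gcd_proj2_if_dvd)
    finally show ?thesis .
  qed
  have sq: "sqrt (real p) ^ a * sqrt (real p) ^ b = sqrt (real p) ^ (a + b)" for a b
    by (simp add: power_add)
  have "(of_nat p :: complex) powr (1 / 2) = of_real (sqrt (real p))"
    using powr_of_real[of "real p" "1 / 2"] p0 by (simp add: powr_half_sqrt)
  then have "Y = of_nat p powr s / of_real (sqrt (real p))"
    by (simp add: Y_def powr_diff)
  moreover have "of_nat (p ^ k) powr s = (of_nat p powr s) ^ k"
    using of_nat_powr[of "p ^ k" s] p0
    by (simp add: of_nat_powr ln_realpow mult_ac flip: exp_of_nat_mult)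
  ultimately have Y: "of_nat (p ^ k) powr s = Y ^ k * of_real (sqrt (real p) ^ k)"
    using p0 by (simp add: power_divide)
  have eq: "Z_term n s (p ^ k) = U (int (p ^ (\<alpha> - k) * m)) (int (p ^ k)) *
      (Y ^ k * of_real (sqrt (real p) ^ k) / of_real (sqrt (real p) ^ min k (\<alpha> - k)))"
    unfolding Z_term_def div gcd Y using p0 u_of_nat_divide[of "p ^ k" "p ^ (\<alpha> - k) * m"]
    by (simp add: real_sqrt_power)
  show ?thesis
  proof (cases "2 * k \<le> \<alpha>")
    case True
    have "p ^ (\<alpha> - k) = p ^ (\<alpha> - 2 * k) * p ^ k"
      using True by (simp flip: power_add)
    then have "U (int (p ^ (\<alpha> - k) * m)) (int (p ^ k)) = U (int (p ^ (\<alpha> - 2 * k) * m)) 1"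
      using U_mult_right[of 1 "int (p ^ k)" "int (p ^ (\<alpha> - 2 * k) * m)"] p0 by (simp add: mult_ac)
    then show ?thesis using eq True p0 by (simp add: min_def)
  next
    case False
    define j where "j = 2 * k - \<alpha>"
    have "U (int (p ^ (\<alpha> - k) * m)) (int (p ^ k)) = U (int m) (int p ^ j)"
    proof -
      have "p ^ k = p ^ j * p ^ (\<alpha> - k)" using False k by (simp add: j_def flip: power_add)
      then show ?thesis
        using U_mult_right[of "int p ^ j" "int (p ^ (\<alpha> - k))" "int m"] p0 by (simp add: mult_ac)
    qed
    moreover have "sqrt (real p) ^ k = sqrt (real p) ^ j * sqrt (real p) ^ (\<alpha> - k)"
      using False k by (simp add: sq j_def)
    moreover have "min k (\<alpha> - k) = \<alpha> - k" using False by simp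
    ultimately show ?thesis
      using eq False p0 unfolding j_def[symmetric] by (simp add: U_normalized_def real_sqrt_power)
  qed
qed

section \<open>Polynomials with all zeros on the unit circle\<close>

lemma norm_eq_1_if_norm_power_eq_1:
  fixes Y :: complex
  assumes "norm (Y ^ b) = 1" "b > 0"
  shows "norm Y = 1"
  using assms power_eq_1_iff[of "norm Y" b] by (simp add: norm_power)

lemma geometric_zero_imp_norm_1:
  fixes Y :: complex
  assumes "(\<Sum>k<a. Y ^ k) = 0" "a > 0"
  shows "norm Y = 1"
proof -
  have "1 - Y ^ a = 0" using one_diff_power_eq[of Y a] assms(1) by simp
  then show ?thesis using assms(2) by (intro norm_eq_1_if_norm_power_eq_1[of Y a]) auto
qed

text \<open>The second block is the first times \<open>c * Y ^ b\<close>, so the sum factors, even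
  with a gap between the blocks.\<close>

lemma two_block_zero_imp_norm_1:
  fixes Y c :: complex
  assumes "(\<Sum>k<a. Y ^ k) + (\<Sum>k=b..<a + b. c * Y ^ k) = 0" "a > 0" "b > 0" "norm c = 1"
  shows "norm Y = 1"
proof -
  have "(\<Sum>k=b..<a + b. c * Y ^ k) = c * Y ^ b * (\<Sum>k<a. Y ^ k)"
    using sum.shift_bounds_nat_ivl[of "\<lambda>k. c * Y ^ k" 0 b a]
    by (simp add: sum_distrib_left power_add mult_ac atLeast0LessThan)
  then have "(1 + c * Y ^ b) * (\<Sum>k<a. Y ^ k) = 0"
    using assms(1) by (simp add: algebra_simps)
  then consider "c * Y ^ b = - 1" | "(\<Sum>k<a. Y ^ k) = 0"
    by (auto simp: add_eq_0_iff)
  then show ?thesis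
  proof cases
    case 1
    then have "norm (c * Y ^ b) = 1" by simp
    then have "norm (Y ^ b) = 1" using assms(4) by (simp add: norm_mult)
    then show ?thesis using assms(3) by (rule norm_eq_1_if_norm_power_eq_1)
  next
    case 2
    then show ?thesis using assms(2) by (rule geometric_zero_imp_norm_1)
  qed
qed

lemma Z_local_zero:
  assumes n: "n > 0" "even n" and p: "prime p" "p dvd n" and zero: "Z_local n p s = 0"
  shows "Re s = 1 / 2"
proof -
  define \<alpha> where "\<alpha> = multiplicity p n"
  obtain m where m: "n = p ^ \<alpha> * m" "\<not> p dvd m"
    using p n unfolding \<alpha>_def by (metis multiplicity_decompose' not_prime_unit less_nat_zero_code)
  have \<alpha>: "\<alpha> > 0" using m p by (cases \<alpha>) auto
  have m0: "m > 0" using m n by (cases m) auto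
  have p1: "p > 1" using p prime_gt_1_nat by blast
  have cop: "coprime p m" using p m by (simp add: prime_imp_coprime)
  have ev: "even p \<or> even m" using n \<alpha> by (simp add: m)
  define Y :: complex where "Y = of_nat p powr (s - 1 / 2)"
  define \<gamma> where "\<gamma> = (\<lambda>j. U_normalized (int m) (int p ^ j))"
  \<comment> \<open>At \<open>j = 0\<close> the evenness of \<open>m * p ^ j\<close> is that of
    \<open>m\<close> itself, hence the side condition.\<close>
  have \<gamma>_step: "\<gamma> (j + 2 * i) = \<gamma> j" if "even m \<or> j > 0" for i j
    unfolding \<gamma>_def using that m0 p1 cop ev by (intro U_normalized_prime_power) auto
  have norm_\<gamma>: "norm (\<gamma> j) = 1" if "j > 0" for j
    unfolding \<gamma>_def using that m0 p1 cop ev by (intro norm_U_normalized) (auto simp: coprime_commute)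
  define c where "c = (\<lambda>k. if 2 * k \<le> \<alpha> then U (int (p ^ (\<alpha> - 2 * k) * m)) 1 else \<gamma> (2 * k - \<alpha>))"
  have "Z_local n p s = (\<Sum>k = 0..\<alpha>. c k * Y ^ k)"
    unfolding Z_local_eq_sum_Z_term[OF p(1)] \<alpha>_def[symmetric]
    using Z_term_prime_power[OF p(1) m(1) m0 m(2)]
    by (intro sum.cong) (auto simp: c_def \<gamma>_def Y_def)
  then have zero': "(\<Sum>k<Suc \<alpha>. c k * Y ^ k) = 0"
    using zero by (simp add: atLeast0AtMost lessThan_Suc_atMost)
  have c_low: "c k = 1" if "2 * k < \<alpha>" for k
    using that ev by (auto simp: c_def U_1)
  have "norm Y = 1"
  proof (cases "even m \<and> even \<alpha>")
    case True
    have "c k = 1" if "k < Suc \<alpha>" for k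
    proof (cases "2 * k \<le> \<alpha>")
      case True
      then show ?thesis using \<open>even m \<and> even \<alpha>\<close> by (simp add: c_def U_1)
    next
      case False
      \<comment> \<open>An even exponent reduces to \<open>\<gamma> 0 = U m 1\<close>, which is 1
        for even \<open>m\<close>.\<close>
      then have "2 * k - \<alpha> = 0 + 2 * (k - \<alpha> div 2)" using \<open>even m \<and> even \<alpha>\<close> by auto
      then have "c k = \<gamma> 0" using False \<gamma>_step[of 0] True by (simp add: c_def)
      then show ?thesis using True by (simp add: \<gamma>_def U_normalized_def U_1)
    qed
    then have "(\<Sum>k<Suc \<alpha>. Y ^ k) = 0" using zero' by simp
    then show ?thesis by (rule geometric_zero_imp_norm_1) simp
  next
    case False
    \<comment> \<open>\<open>b\<close> is the first index with \<open>2 * k > \<alpha>\<close>, and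
      \<open>a\<close> counts the indices from \<open>b\<close> to \<open>\<alpha>\<close>. For odd
      \<open>\<alpha>\<close>, \<open>a = b\<close>; for even \<open>\<alpha>\<close>,
      \<open>m\<close> is odd and the single middle coefficient vanishes.\<close>
    define b where "b = Suc (\<alpha> div 2)"
    define a where "a = Suc \<alpha> - b"
    define j where "j = 2 * b - \<alpha>"
    have ab: "a > 0" "b > 0" "j > 0" "a \<le> b" "Suc \<alpha> = a + b" using \<alpha> by (auto simp: a_def b_def j_def)
    have c_high: "c k = \<gamma> j" if "b \<le> k" for k
    proof -
      have "\<not> 2 * k \<le> \<alpha>" "2 * k - \<alpha> = j + 2 * (k - b)" using that by (auto simp: b_def j_def)
      then show ?thesis using \<gamma>_step[of j "k - b"] ab by (simp add: c_def)
    qed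
    have c_mid: "c k = 0" if "a \<le> k" "k < b" for k
    proof -
      have "2 * k = \<alpha>" using that by (auto simp: a_def b_def)
      then show ?thesis using False by (auto simp: c_def U_1)
    qed
    have "(\<Sum>k<Suc \<alpha>. c k * Y ^ k) =
        (\<Sum>k<a. c k * Y ^ k) + ((\<Sum>k=a..<b. c k * Y ^ k) + (\<Sum>k=b..<a + b. c k * Y ^ k))"
      unfolding atLeast0LessThan[symmetric] using ab by (simp only: sum.atLeastLessThan_concat)
    also have "(\<Sum>k<a. c k * Y ^ k) = (\<Sum>k<a. Y ^ k)"
      using c_low by (intro sum.cong) (auto simp: a_def b_def)
    also have "(\<Sum>k=a..<b. c k * Y ^ k) = 0"
      using c_mid by simp
    also have "(\<Sum>k=b..<a + b. c k * Y ^ k) = (\<Sum>k=b..<a + b. \<gamma> j * Y ^ k)"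
      using c_high by simp
    finally have "(\<Sum>k<a. Y ^ k) + (\<Sum>k=b..<a + b. \<gamma> j * Y ^ k) = 0"
      using zero' by simp
    then show ?thesis using ab(1,2) norm_\<gamma>[OF ab(3)] by (rule two_block_zero_imp_norm_1)
  qed
  moreover have "norm Y = real p powr (Re s - 1 / 2)"
    unfolding Y_def by (subst norm_powr_real_powr) auto
  ultimately show ?thesis using p1 by (simp add: powr_eq_one_iff)
qed

theorem theoremA:
  fixes n :: nat and w :: complex
  assumes "n > 0" and "even n" and "w = exp (of_real pi * \<i> / 4)"
  shows "(\<forall>s. L n (1 - s) = w * cnj (L n (cnj s))) \<and>
    (\<forall>s. Z n s = (\<Prod>p \<in> {p. prime p \<and> p dvd n}. Z_local n p s)) \<and>
    (\<forall>s. Z n s = 0 \<longrightarrow> Re s = 1 / 2)"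
proof (intro conjI allI impI)
  have "w = cis (pi / 4)" by (simp add: assms(3) cis_conv_exp mult.commute)
  then show "L n (1 - s) = w * cnj (L n (cnj s))" for s
    using L_functional_equation[OF assms(1)] by simp
  show prod: "Z n s = (\<Prod>p \<in> {p. prime p \<and> p dvd n}. Z_local n p s)" for s
    using assms by (intro Z_eq_prod_Z_local)
  fix s assume "Z n s = 0"
  then obtain p where "prime p" "p dvd n" "Z_local n p s = 0"
    using assms(1) finite_prime_divisors[of n] by (auto simp: prod prod_zero_iff)
  then show "Re s = 1 / 2" using assms Z_local_zero by blast
qed

end
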